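(* Let $k$ be any positive integer. (1) The set $\mathcal{P}_{\cup_k}$ forms an abelian group under concatenation and reduction modulo $k$, $\cup_k$. (2) The set $\mathcal{P}_k^+$ forms an abelian group under component-wise addition and reduction modulo $k$, $+_k$.
   Context: A partition is a finite weakly decreasing sequence $\lambda=(\lambda_1,\dots,\lambda_\ell)$ of positive integers; the empty partition $\emptyset$ is allowed; $\ell(\lambda)=\ell$ is its length; by convention $\lambda_j=0$ for $j>\ell(\lambda)$. $\mathcal{P}$ is the set of all partitions. $\mathcal{P}_{\cup_k}$ is the set of partitions in which every part has multiplicity less than $k$. Multiplicity reduction modulo $k$ repeatedly removes any $k$ parts of the same size until every part has multiplicity less than $k$. For partitions $\lambda,\pi$, $\lambda\cup_k\pi$ is obtained by concatenating the parts of $\lambda$ and $\pi$, reordering into weakly decreasing order, and then performing multiplicity reduction modulo $k$. $\mathcal{P}_k^+$ is the set of partitions in which the difference between any two consecutive parts is less than $k$ and the smallest part is less than $k$ (it contains $\emptyset$). Component-wise reduction modulo $k$ sends a partition $\lambda=(\lambda_1,\dots,\lambda_\ell)$ to $\lambda'=(\lambda_1',\dots,\lambda_\ell')$ (trailing zeros omitted; $\emptyset\mapsto\emptyset$), where $\lambda_\ell'=\lambda_\ell-\lfloor\lambda_\ell/k\rfloor k$ and, recursively for $j=\ell-1,\dots,1$, $\lambda_j'=\lambda_j-\left\lfloor(\lambda_j-\lambda_{j+1}')/k\right\rfloor k$. For partitions $\lambda,\pi$, $\lambda+_k\pi$ is the component-wise reduction modulo $k$ of the partition $(\lambda_1+\pi_1,\lambda_2+\pi_2,\dots)$.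 *)

theory Defs
  imports "HOL-Library.Multiset" "HOL-Library.More_List" "HOL-Algebra.Group"
begin

definition is_partition :: "nat list \<Rightarrow> bool" where
  "is_partition l \<longleftrightarrow> sorted_wrt (\<ge>) l \<and> (\<forall>x\<in>set l. 0 < x)"

definition P_cup :: "nat \<Rightarrow> nat list set" where
  "P_cup k = {l. is_partition l \<and> (\<forall>x\<in>set l. count_list l x < k)}"

definition removes :: "nat \<Rightarrow> nat list \<Rightarrow> nat list \<Rightarrow> bool" where
  "removes k l m \<longleftrightarrow> is_partition m \<and> (\<exists>x. mset l = mset m + replicate_mset k x)"

(* The outcome does not depend on the order of the removals: see mult_reduction_unique. *)
definition mult_reduction :: "nat \<Rightarrow> nat list \<Rightarrow> nat list" where
  "mult_reduction k l = (THE m. (removes k)\<^sup>*\<^sup>* l m \<and> m \<in> P_cup k)"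

definition cup_mod :: "nat \<Rightarrow> nat list \<Rightarrow> nat list \<Rightarrow> nat list" where
  "cup_mod k l m = mult_reduction k (rev (sort (l @ m)))"

(* In a partition the subtraction l ! i - l ! Suc i never truncates. *)
definition P_plus :: "nat \<Rightarrow> nat list set" where
  "P_plus k = {l. is_partition l \<and> (\<forall>i. Suc i < length l \<longrightarrow> l ! i - l ! Suc i < k) \<and>
     (l \<noteq> [] \<longrightarrow> last l < k)}"

(* For a weakly decreasing list, hd r \<le> y \<le> x in the last equation, so x - hd r does not
   truncate; the result is again weakly decreasing, so its zeros are all trailing. *)
fun comp_residues :: "nat \<Rightarrow> nat list \<Rightarrow> nat list" where
  "comp_residues k [] = []"
| "comp_residues k [x] = [x - (x div k) * k]"
| "comp_residues k (x # y # zs) =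
     (let r = comp_residues k (y # zs) in (x - ((x - hd r) div k) * k) # r)"

definition comp_reduction :: "nat \<Rightarrow> nat list \<Rightarrow> nat list" where
  "comp_reduction k l = strip_while (\<lambda>x. x = 0) (comp_residues k l)"

definition comp_sum :: "nat list \<Rightarrow> nat list \<Rightarrow> nat list" where
  "comp_sum l m =
     map (\<lambda>i. nth_default 0 l i + nth_default 0 m i) [0..<max (length l) (length m)]"

definition plus_mod :: "nat \<Rightarrow> nat list \<Rightarrow> nat list \<Rightarrow> nat list" where
  "plus_mod k l m = comp_reduction k (comp_sum l m)"

definition cup_group :: "nat \<Rightarrow> nat list monoid" where
  "cup_group k = \<lparr>carrier = P_cup k, monoid.mult = cup_mod k, one = []\<rparr>"

definition plus_group :: "nat \<Rightarrow> nat list monoid" where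
  "plus_group k = \<lparr>carrier = P_plus k, monoid.mult = plus_mod k, one = []\<rparr>"

lemma partition_eqI:
  assumes "is_partition l" "is_partition m" "mset l = mset m"
  shows "l = m"
proof -
  have "sorted (rev l)" "sorted (rev m)"
    using assms(1,2) by (simp_all add: is_partition_def sorted_wrt_rev)
  moreover have "mset (rev l) = mset (rev m)" using assms(3) by simp
  ultimately have "rev l = rev m" by (metis properties_for_sort)
  then show ?thesis by simp
qed

lemma removes_star_invariant:
  assumes "(removes k)\<^sup>*\<^sup>* l m" "is_partition l"
  shows "is_partition m \<and> (\<forall>x. count (mset m) x mod k = count (mset l) x mod k)"
  using assms
proof (induction rule: rtranclp_induct)
  case (step m m')
  then obtain x where "mset m = mset m' + replicate_mset k x" "is_partition m'"
    by (auto simp: removes_def)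
  then have "count (mset m) y mod k = count (mset m') y mod k" for y
    by simp
  with step \<open>is_partition m'\<close> show ?case by simp
qed simp

lemma mult_reduction_unique:
  assumes "0 < k" "is_partition l"
  shows "\<exists>!m. (removes k)\<^sup>*\<^sup>* l m \<and> m \<in> P_cup k"
proof (rule ex_ex1I)
  show "\<exists>m. (removes k)\<^sup>*\<^sup>* l m \<and> m \<in> P_cup k"
    using assms(2)
  proof (induction "length l" arbitrary: l rule: less_induct)
    case less
    show ?case
    proof (cases "l \<in> P_cup k")
      case False
      then obtain x where "k \<le> count (mset l) x"
        using less.prems by (force simp: P_cup_def count_mset not_less)
      then have sub: "replicate_mset k x \<subseteq># mset l"
        by (simp add: count_le_replicate_mset_subset_eq)
      define m where "m = rev (sorted_list_of_multiset (mset l - replicate_mset k x))"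
      have ms: "mset l = mset m + replicate_mset k x"
        using sub by (simp add: m_def)
      have "set_mset (mset m) \<subseteq> set_mset (mset l)"
        unfolding ms by simp
      then have "set m \<subseteq> set l" by simp
      then have "is_partition m"
        using less.prems by (auto simp: is_partition_def m_def sorted_wrt_rev)
      then have rem: "removes k l m" using ms by (auto simp: removes_def)
      have "size (mset l) = size (mset m) + k" using ms by simp
      then have "length m < length l" using assms(1) by simp
      from less.hyps[OF this \<open>is_partition m\<close>] rem show ?thesis
        by (meson converse_rtranclp_into_rtranclp)
    qed blast
  qed
next
  fix m m'
  assume m: "(removes k)\<^sup>*\<^sup>* l m \<and> m \<in> P_cup k" and m': "(removes k)\<^sup>*\<^sup>* l m' \<and> m' \<in> P_cup k"
  have small: "count (mset n) x < k" if "n \<in> P_cup k" for n x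
    using that assms(1) by (cases "x \<in> set n") (auto simp: P_cup_def count_mset)
  have "count (mset m) x = count (mset m') x" for x
  proof -
    have "count (mset m) x mod k = count (mset m') x mod k"
      using removes_star_invariant[of k l m] removes_star_invariant[of k l m'] m m' assms(2)
      by simp
    then show ?thesis using small m m' by simp
  qed
  then show "m = m'"
    using m m' by (auto intro!: partition_eqI multiset_eqI simp: P_cup_def)
qed

end

theory Submission imports Defs "HOL-Number_Theory.Cong" begin

text \<open>Both groups embed into a power of \<open>\<int>/k\<close>: a partition in \<open>P_cup k\<close> is determined by the
  multiplicities of its parts modulo \<open>k\<close>, one in \<open>P_plus k\<close> by its components modulo \<open>k\<close>, and the
  two operations become addition of residues. As every residue is killed by \<open>k\<close>, the
  \<open>(k - 1)\<close>-st power of an element is its inverse, so that a carrier closed under the operation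
  and containing the neutral element is already a group.\<close>

section \<open>Abelian groups from an embedding into residues\<close>

lemma comm_group_residue_embedding:
  fixes G (structure) and \<phi> :: "'a \<Rightarrow> 'i \<Rightarrow> nat"
  assumes "0 < k"
    and one: "\<one> \<in> carrier G" "\<And>i. [\<phi> \<one> i = 0] (mod k)"
    and closed: "\<And>x y. \<lbrakk>x \<in> carrier G; y \<in> carrier G\<rbrakk> \<Longrightarrow> x \<otimes> y \<in> carrier G"
    and mult: "\<And>x y i. \<lbrakk>x \<in> carrier G; y \<in> carrier G\<rbrakk> \<Longrightarrow> [\<phi> (x \<otimes> y) i = \<phi> x i + \<phi> y i] (mod k)"
    and inj: "\<And>x y. \<lbrakk>x \<in> carrier G; y \<in> carrier G; \<And>i. [\<phi> x i = \<phi> y i] (mod k)\<rbrakk> \<Longrightarrow> x = y"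
  shows "comm_group G"
proof -
  \<comment> \<open>Each monoid law holds for sums of residues, and \<open>inj\<close> lifts it to
    the carrier.\<close>
  have M: "comm_monoid G"
  proof (rule comm_monoidI)
    fix x y z assume xyz: "x \<in> carrier G" "y \<in> carrier G" "z \<in> carrier G"
    show "x \<otimes> y \<otimes> z = x \<otimes> (y \<otimes> z)"
    proof (rule inj)
      fix i
      have "[\<phi> (x \<otimes> y \<otimes> z) i = \<phi> x i + \<phi> y i + \<phi> z i] (mod k)"
        using xyz by (meson closed cong_add cong_refl cong_trans mult)
      moreover have "[\<phi> (x \<otimes> (y \<otimes> z)) i = \<phi> x i + (\<phi> y i + \<phi> z i)] (mod k)"
        using xyz by (meson closed cong_add cong_refl cong_trans mult)
      ultimately show "[\<phi> (x \<otimes> y \<otimes> z) i = \<phi> (x \<otimes> (y \<otimes> z)) i] (mod k)"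
        by (simp add: cong_def add.assoc)
    qed (use xyz in \<open>auto intro: closed\<close>)
  next
    fix x assume x: "x \<in> carrier G"
    show "\<one> \<otimes> x = x"
    proof (rule inj)
      fix i
      have "[\<phi> \<one> i + \<phi> x i = 0 + \<phi> x i] (mod k)"
        by (intro cong_add one cong_refl)
      then show "[\<phi> (\<one> \<otimes> x) i = \<phi> x i] (mod k)"
        using mult[OF one(1) x, of i] by (simp add: cong_def)
    qed (use x in \<open>auto intro: closed one\<close>)
  next
    fix x y assume xy: "x \<in> carrier G" "y \<in> carrier G"
    show "x \<otimes> y = y \<otimes> x"
    proof (rule inj)
      fix i
      show "[\<phi> (x \<otimes> y) i = \<phi> (y \<otimes> x) i] (mod k)"
        using mult[OF xy, of i] mult[OF xy(2,1), of i] by (simp add: cong_def add.commute)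
    qed (use xy in \<open>auto intro: closed\<close>)
  qed (auto intro: closed one)
  interpret comm_monoid G by (rule M)
  have pow: "[\<phi> (x [^] n) i = n * \<phi> x i] (mod k)" if x: "x \<in> carrier G" for x i and n :: nat
  proof (induction n)
    case (Suc n)
    have "[\<phi> (x [^] n) i + \<phi> x i = n * \<phi> x i + \<phi> x i] (mod k)"
      by (intro cong_add Suc cong_refl)
    then show ?case
      using mult[of "x [^] n" x i] x by (simp add: cong_def add.commute)
  qed (simp add: one)
  show ?thesis
  proof (rule comm_groupI)
    fix x assume x: "x \<in> carrier G"
    have "x [^] (k - 1) \<otimes> x = x [^] k"
      using \<open>0 < k\<close> by (metis Suc_diff_1 nat_pow_Suc)
    also have "\<dots> = \<one>"
    proof (rule inj)
      show "[\<phi> (x [^] k) i = \<phi> \<one> i] (mod k)" for i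
        using pow[OF x, of k i] one(2)[of i] by (simp add: cong_def)
    qed (use x in auto)
    finally show "\<exists>y\<in>carrier G. y \<otimes> x = \<one>"
      using x by blast
  qed (auto simp: m_assoc intro: m_comm)
qed

section \<open>Multiplicities modulo \<open>k\<close>\<close>

lemma P_cup_count_less:
  assumes "0 < k" "l \<in> P_cup k"
  shows "count (mset l) x < k"
  using assms by (cases "x \<in> set l") (auto simp: P_cup_def count_mset)

text \<open>Unique existence of the reduct turns the description operator into the property it
  describes. Each removal takes away \<open>k\<close> copies of one part, so multiplicities are
  preserved modulo \<open>k\<close>.\<close>

lemma
  assumes "0 < k" "l \<in> P_cup k" "m \<in> P_cup k"
  shows cup_mod_in_P_cup: "cup_mod k l m \<in> P_cup k"
    and count_cup_mod: "[count (mset (cup_mod k l m)) x = count (mset l) x + count (mset m) x] (mod k)"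
proof -
  let ?s = "rev (sort (l @ m))"
  have p: "is_partition ?s"
    using assms by (auto simp: P_cup_def is_partition_def sorted_wrt_rev)
  have *: "(removes k)\<^sup>*\<^sup>* ?s (cup_mod k l m) \<and> cup_mod k l m \<in> P_cup k"
    using theI'[OF mult_reduction_unique[OF assms(1) p]]
    unfolding cup_mod_def mult_reduction_def .
  then show "cup_mod k l m \<in> P_cup k" by simp
  show "[count (mset (cup_mod k l m)) x = count (mset l) x + count (mset m) x] (mod k)"
    using removes_star_invariant[of k ?s "cup_mod k l m"] * p by (simp add: cong_def)
qed

lemma comm_group_cup_group:
  assumes "0 < k"
  shows "comm_group (cup_group k)"
proof (rule comm_group_residue_embedding[where \<phi> = "\<lambda>l. count (mset l)", OF assms])
  fix l m
  assume lm: "l \<in> carrier (cup_group k)" "m \<in> carrier (cup_group k)"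
    and cong: "\<And>x. [count (mset l) x = count (mset m) x] (mod k)"
  \<comment> \<open>Both multiplicities lie below \<open>k\<close>, where congruence is
    equality.\<close>
  then have "count (mset l) x = count (mset m) x" for x
    using cong_less_modulus_unique_nat[OF cong[of x]] P_cup_count_less[OF assms]
    by (simp add: cup_group_def)
  then have "mset l = mset m" by (rule multiset_eqI)
  then show "l = m"
    using lm by (auto intro: partition_eqI simp: cup_group_def P_cup_def)
next
  show "\<one>\<^bsub>cup_group k\<^esub> \<in> carrier (cup_group k)"
    by (simp add: cup_group_def P_cup_def is_partition_def)
qed (simp_all add: cup_group_def cup_mod_in_P_cup[OF assms] count_cup_mod[OF assms])

section \<open>Partitions as weakly decreasing sequences padded with zeros\<close>

lemma sorted_ge_iff_antimono:
  fixes l :: "nat list"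
  shows "sorted_wrt (\<ge>) l \<longleftrightarrow> antimono (nth_default 0 l)"
proof
  assume "sorted_wrt (\<ge>) l"
  then have "nth_default 0 l (Suc i) \<le> nth_default 0 l i" for i
    by (auto simp: nth_default_def sorted_wrt_iff_nth_less)
  then show "antimono (nth_default 0 l)" by (simp add: antimono_iff_le_Suc)
next
  assume anti: "antimono (nth_default 0 l)"
  have "l ! j \<le> l ! i" if "i < j" "j < length l" for i j
    using antimonoD[OF anti, of i j] that by (simp add: nth_default_def)
  then show "sorted_wrt (\<ge>) l" by (simp add: sorted_wrt_iff_nth_less)
qed

text \<open>The last entry of a weakly decreasing list is its smallest, so positivity need only be
  checked there. This is the form in which stripping trailing zeros yields a partition.\<close>

lemma is_partition_iff_antimono:
  "is_partition l \<longleftrightarrow> antimono (nth_default 0 l) \<and> (l \<noteq> [] \<longrightarrow> last l \<noteq> 0)"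
proof -
  have "last l \<le> x" if "sorted_wrt (\<ge>) l" "x \<in> set l" for x
    using that by (induction l) auto
  then have "(\<forall>x\<in>set l. 0 < x) \<longleftrightarrow> (l \<noteq> [] \<longrightarrow> last l \<noteq> 0)" if "sorted_wrt (\<ge>) l"
    using that by (cases "l = []") fastforce+
  then show ?thesis
    unfolding is_partition_def sorted_ge_iff_antimono[symmetric] by blast
qed

text \<open>After padding, the bound on the smallest part is the gap condition at the last index,
  where the next entry is 0. Beyond the end the condition reads \<open>0 < k\<close>. The additive
  form avoids truncated subtraction.\<close>

lemma P_plus_iff:
  assumes "0 < k"
  shows "l \<in> P_plus k \<longleftrightarrow>
    is_partition l \<and> (\<forall>i. nth_default 0 l i < nth_default 0 l (Suc i) + k)"
  (is "_ \<longleftrightarrow> ?R")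
proof
  assume l: "l \<in> P_plus k"
  have "nth_default 0 l i < nth_default 0 l (Suc i) + k" for i
  proof -
    consider "Suc i < length l" | "l \<noteq> []" "i = length l - 1" | "length l \<le> i" by fastforce
    then show ?thesis
    proof cases
      case 2
      then show ?thesis using l by (auto simp: P_plus_def nth_default_def last_conv_nth)
    qed (use l assms in \<open>auto simp: P_plus_def nth_default_def\<close>)
  qed
  then show ?R using l by (simp add: P_plus_def)
next
  assume R: ?R
  then have R': "nth_default 0 l i < nth_default 0 l (Suc i) + k" for i by blast
  have "l ! i - l ! Suc i < k" if "Suc i < length l" for i
    using R'[of i] that assms by (simp add: nth_default_def)
  moreover have "last l < k" if "l \<noteq> []"
    using R'[of "length l - 1"] that by (simp add: nth_default_def last_conv_nth)
  ultimately show "l \<in> P_plus k" using R by (simp add: P_plus_def)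
qed

text \<open>If \<open>l\<close> were longer, its last part would face a padding zero of
  \<open>m\<close> and be divisible by \<open>k\<close>, although it lies strictly between 0 and
  \<open>k\<close>.\<close>

lemma P_plus_length_le:
  assumes "l \<in> P_plus k" and cong: "\<And>i. [nth_default 0 l i = nth_default 0 m i] (mod k)"
  shows "length l \<le> length m"
proof (rule ccontr)
  assume "\<not> length l \<le> length m"
  then have n: "l \<noteq> []" "length m \<le> length l - 1" by auto
  then have "[last l = 0] (mod k)"
    using cong[of "length l - 1"] by (simp add: nth_default_def last_conv_nth)
  moreover have "0 < last l" "last l < k"
    using assms(1) n by (auto simp: P_plus_def is_partition_def)
  ultimately show False by (simp add: cong_def)
qed

text \<open>Entries are compared from the end backwards, starting at the padding zeros just past the
  common length. Once the next entries agree on a value c, both current entries lie in the interval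
  [c, c + k), which contains each residue only once.\<close>

lemma P_plus_eqI:
  assumes "0 < k" and l: "l \<in> P_plus k" and m: "m \<in> P_plus k"
    and cong: "\<And>i. [nth_default 0 l i = nth_default 0 m i] (mod k)"
  shows "l = m"
proof -
  have len: "length l = length m"
    using P_plus_length_le[OF l, of m] P_plus_length_le[OF m, of l] cong
    by (simp add: cong_sym_eq)
  have anti: "antimono (nth_default 0 l)" "antimono (nth_default 0 m)"
    using l m by (simp_all add: P_plus_iff[OF \<open>0 < k\<close>] is_partition_iff_antimono)
  have "nth_default 0 l i = nth_default 0 m i" if "i \<le> length l" for i
    using that
  proof (induction rule: inc_induct)
    case base
    show ?case using len by (simp add: nth_default_def)
  next
    case (step i)
    let ?a = "nth_default 0 l i" and ?b = "nth_default 0 m i" and ?c = "nth_default 0 l (Suc i)"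
    have *: "?c \<le> ?a" "?c \<le> ?b" "?a < ?c + k" "?b < ?c + k"
      using l m step.IH anti[THEN antimonoD, of i "Suc i"]
      by (simp_all add: P_plus_iff[OF \<open>0 < k\<close>]) metis
    then have "[?a - ?c = ?b - ?c] (mod k)"
      by (intro cong_diff_nat cong cong_refl)
    with * have "?a - ?c = ?b - ?c"
      by (intro cong_less_modulus_unique_nat) auto
    then show ?case using * by simp
  qed
  then have "l ! i = m ! i" if "i < length l" for i
    using that len by (metis less_imp_le nth_default_nth)
  then show ?thesis using len by (rule nth_equalityI[rotated])
qed

section \<open>Component-wise reduction\<close>

lemma length_comp_residues [simp]: "length (comp_residues k l) = length l"
  by (induction k l rule: comp_residues.induct) (simp_all add: Let_def)

text \<open>The default 0 for the head of an empty tail merges the singleton clause with the general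
  one.\<close>

lemma comp_residues_Cons:
  "comp_residues k (x # xs) =
    (x - (x - nth_default 0 (comp_residues k xs) 0) div k * k) # comp_residues k xs"
proof (cases xs)
  case (Cons y ys)
  then have "comp_residues k xs \<noteq> []"
    using length_comp_residues[of k xs] by (metis length_0_conv list.distinct(1))
  then show ?thesis
    using Cons by (simp add: Let_def nth_default_def hd_conv_nth)
qed simp

text \<open>Each reduced entry is the representative of the original one in the window of length
  \<open>k\<close> that starts at the next reduced entry. The bound \<open>r i \<le> f i\<close> is
  carried along because the induction needs it to rule out truncation.\<close>

lemma comp_residues_spec:
  assumes "0 < k" "antimono (nth_default 0 l)"
  defines "r \<equiv> nth_default 0 (comp_residues k l)" and "f \<equiv> nth_default 0 l"
  shows "r i \<le> f i" "r (Suc i) \<le> r i" "r i < r (Suc i) + k" "[r i = f i] (mod k)"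
proof -
  have "r i \<le> f i \<and> r (Suc i) \<le> r i \<and> r i < r (Suc i) + k \<and> [r i = f i] (mod k)"
    using assms(2) unfolding r_def f_def
  proof (induction l arbitrary: i)
    case Nil
    then show ?case using \<open>0 < k\<close> by simp
  next
    case (Cons x xs)
    let ?h = "nth_default 0 (comp_residues k xs) 0"
    have anti: "antimono (nth_default 0 xs)"
      using Cons.prems by (simp flip: sorted_ge_iff_antimono)
    show ?case
    proof (cases i)
      case 0
      have "?h \<le> nth_default 0 xs 0" using Cons.IH[OF anti] by blast
      also have "\<dots> \<le> x" using antimonoD[OF Cons.prems, of 0 1] by simp
      finally have "?h \<le> x" .
      define a where "a = x - (x - ?h) div k * k"
      have "x - ?h = (x - ?h) div k * k + (x - ?h) mod k" by simp
      \<comment> \<open>This form places \<open>a\<close> in the window above \<open>?h\<close> and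
        shows its residue.\<close>
      then have a: "a = ?h + (x - ?h) mod k"
        unfolding a_def using \<open>?h \<le> x\<close> by linarith
      then have "a mod k = x mod k"
        using \<open>?h \<le> x\<close> by (simp add: mod_add_right_eq)
      moreover have "?h \<le> a" "a < ?h + k" using a \<open>0 < k\<close> by simp_all
      moreover have "a \<le> x" by (simp add: a_def)
      ultimately show ?thesis
        using 0 by (simp add: comp_residues_Cons cong_def flip: a_def)
    next
      case (Suc j)
      then show ?thesis using Cons.IH[OF anti, of j] by (simp add: comp_residues_Cons)
    qed
  qed
  then show "r i \<le> f i" "r (Suc i) \<le> r i" "r i < r (Suc i) + k" "[r i = f i] (mod k)"
    by simp_all
qed

lemma comp_reduction_alt: "comp_reduction k l = strip_while ((=) 0) (comp_residues k l)"
proof -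
  have "(\<lambda>x::nat. x = 0) = (=) 0" by auto
  then show ?thesis by (simp only: comp_reduction_def)
qed

text \<open>Stripping trailing zeros leaves the padded sequence unchanged, so the properties of
  \<open>comp_residues\<close> carry over, and the last remaining entry is nonzero.\<close>

lemma
  assumes "0 < k" "antimono (nth_default 0 l)"
  shows comp_reduction_in_P_plus: "comp_reduction k l \<in> P_plus k"
    and nth_default_comp_reduction:
      "[nth_default 0 (comp_reduction k l) i = nth_default 0 l i] (mod k)"
proof -
  have "last (comp_reduction k l) \<noteq> 0" if "comp_reduction k l \<noteq> []"
    using that no_trailing_strip_while[of "(=) 0" "comp_residues k l"]
    unfolding comp_reduction_alt no_trailing_unfold by metis
  then show "comp_reduction k l \<in> P_plus k"
    using comp_residues_spec[OF assms]
    by (simp add: P_plus_iff[OF assms(1)] is_partition_iff_antimono antimono_iff_le_Suc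
        comp_reduction_alt)
  show "[nth_default 0 (comp_reduction k l) i = nth_default 0 l i] (mod k)"
    using comp_residues_spec[OF assms] by (simp add: comp_reduction_alt)
qed

lemma nth_default_comp_sum:
  "nth_default 0 (comp_sum l m) i = nth_default 0 l i + nth_default 0 m i"
  by (auto simp: comp_sum_def nth_default_def)

lemma comm_group_plus_group:
  assumes "0 < k"
  shows "comm_group (plus_group k)"
proof (rule comm_group_residue_embedding[where \<phi> = "nth_default 0", OF assms])
  fix l m
  assume "l \<in> carrier (plus_group k)" "m \<in> carrier (plus_group k)"
  \<comment> \<open>Sums of weakly decreasing sequences are weakly decreasing, as the reduction
    lemmas require.\<close>
  then have "antimono (nth_default 0 (comp_sum l m))"
    by (simp add: plus_group_def P_plus_def is_partition_iff_antimono antimono_iff_le_Suc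
        nth_default_comp_sum add_mono)
  note s = assms this
  show "l \<otimes>\<^bsub>plus_group k\<^esub> m \<in> carrier (plus_group k)"
    by (simp add: plus_group_def plus_mod_def comp_reduction_in_P_plus[OF s])
  show "[nth_default 0 (l \<otimes>\<^bsub>plus_group k\<^esub> m) i = nth_default 0 l i + nth_default 0 m i] (mod k)" for i
    using nth_default_comp_reduction[OF s, of i]
    by (simp add: plus_group_def plus_mod_def nth_default_comp_sum)
next
  show "\<one>\<^bsub>plus_group k\<^esub> \<in> carrier (plus_group k)"
    by (simp add: plus_group_def P_plus_def is_partition_def)
qed (simp_all add: plus_group_def P_plus_eqI[OF assms])

theorem theorem4:
  fixes k :: nat
  assumes "0 < k"
  shows "comm_group (cup_group k) \<and> comm_group (plus_group k)"
  using assms by (simp add: comm_group_cup_group comm_group_plus_group)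

end
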